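(* Let $N_n$ be the number of $\alpha\in\mathcal{DP}_n$ with no fixed point. Then $$N_n=\frac{13\cdot 2^n-(3n^2+9n+10)}{3}\quad\text{if } n\ge 0 \text{ is even},$$ and $$N_n=\frac{25\cdot 2^{n-1}-(3n^2+9n+10)}{3}\quad\text{if } n\ge 1 \text{ is odd}.$$
   Context: For $n\ge 0$ let $X_n=\{1,2,\dots,n\}$ and let $\mathcal{I}_n$ be the set of all partial injective maps of $X_n$ (including the empty map). $\mathcal{DP}_n$ is the set of all $\alpha\in\mathcal{I}_n$ with $|x-y|=|x\alpha-y\alpha|$ for all $x,y\in\mathrm{Dom}\,\alpha$ (partial isometries; $x\alpha$ denotes the image of $x$ under $\alpha$). A fixed point of $\alpha$ is an $x\in\mathrm{Dom}\,\alpha$ with $x\alpha=x$. *)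

theory Defs
  imports Complex_Main
begin

definition chain :: "nat \<Rightarrow> nat set" where
  "chain n = {1..n}"

text \<open>A partial map of \<open>chain n\<close> is represented as a map \<open>nat \<rightharpoonup> nat\<close>, undefined outside
  its domain, so that distinct partial maps are distinct functions.\<close>

definition partial_injections :: "nat \<Rightarrow> (nat \<rightharpoonup> nat) set" where
  "partial_injections n =
     {\<alpha>. dom \<alpha> \<subseteq> chain n \<and> ran \<alpha> \<subseteq> chain n \<and> inj_on \<alpha> (dom \<alpha>)}"

text \<open>Distances are taken in the integers, since subtraction of naturals truncates.\<close>

definition partial_isometries :: "nat \<Rightarrow> (nat \<rightharpoonup> nat) set" where
  "partial_isometries n =
     {\<alpha> \<in> partial_injections n. \<forall>x\<in>dom \<alpha>. \<forall>y\<in>dom \<alpha>.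
        \<bar>int x - int y\<bar> = \<bar>int (the (\<alpha> x)) - int (the (\<alpha> y))\<bar>}"

definition fixed_points :: "(nat \<rightharpoonup> nat) \<Rightarrow> nat set" where
  "fixed_points \<alpha> = {x \<in> dom \<alpha>. the (\<alpha> x) = x}"

definition fixed_point_free_isometries :: "nat \<Rightarrow> (nat \<rightharpoonup> nat) set" where
  "fixed_point_free_isometries n = {\<alpha> \<in> partial_isometries n. fixed_points \<alpha> = {}}"

end

theory Submission
  imports Defs
begin

text \<open>A nonempty partial isometry is the restriction of a translation \<open>x \<mapsto> c + x\<close> or of a
  reflection \<open>x \<mapsto> c - x\<close>, and of both exactly when its rank is one. For fixed \<open>c\<close> the
  fixed-point-free restrictions correspond to the nonempty subsets of the largest possible domain,
  so the count follows by inclusion-exclusion and geometric sums.\<close>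

section \<open>Restrictions of one affine map with slope \<open>e\<close> and offset
  \<open>c\<close>\<close>

definition affine_domain :: "int \<Rightarrow> nat \<Rightarrow> int \<Rightarrow> nat set" where
  "affine_domain e n c =
     {x. 1 \<le> x \<and> x \<le> n \<and> 1 \<le> c + e * int x \<and> c + e * int x \<le> int n \<and> c + e * int x \<noteq> int x}"

text \<open>The slope is kept as a parameter so that translations (\<open>e = 1\<close>) and
  reflections (\<open>e = -1\<close>) share the counting. The empty map is excluded because it would
  lie in every family and destroy disjointness.\<close>

definition affine_maps :: "int \<Rightarrow> nat \<Rightarrow> int \<Rightarrow> (nat \<rightharpoonup> nat) set" where
  "affine_maps e n c =
     {\<alpha>. \<alpha> \<noteq> Map.empty \<and> dom \<alpha> \<subseteq> affine_domain e n c \<and>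
          (\<forall>x\<in>dom \<alpha>. \<alpha> x = Some (nat (c + e * int x)))}"

lemma finite_affine_domain [simp]: "finite (affine_domain e n c)"
  by (rule finite_subset[of _ "{..n}"]) (auto simp: affine_domain_def)

lemma bij_betw_dom_affine_maps:
  "bij_betw dom (affine_maps e n c) (Pow (affine_domain e n c) - {{}})"
proof (rule bij_betw_byWitness[where f' = "\<lambda>A x. if x \<in> A then Some (nat (c + e * int x)) else None"])
  show "\<forall>\<alpha>\<in>affine_maps e n c.
          (\<lambda>x. if x \<in> dom \<alpha> then Some (nat (c + e * int x)) else None) = \<alpha>"
    by (auto simp: affine_maps_def fun_eq_iff domIff)
  show "(\<lambda>A x. if x \<in> A then Some (nat (c + e * int x)) else None) `
          (Pow (affine_domain e n c) - {{}}) \<subseteq> affine_maps e n c"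
    by (force simp: affine_maps_def dom_def fun_eq_iff split: if_splits)
qed (auto simp: affine_maps_def dom_def split: if_splits)

lemma finite_affine_maps [simp]: "finite (affine_maps e n c)"
  using bij_betw_finite[OF bij_betw_dom_affine_maps] by simp

lemma card_affine_maps: "card (affine_maps e n c) = 2 ^ card (affine_domain e n c) - 1"
  using bij_betw_same_card[OF bij_betw_dom_affine_maps, of e n c]
  by (simp add: card_Diff_subset card_Pow)

text \<open>One point \<open>x\<close> of the domain already determines the offset, as its image
  minus \<open>e * int x\<close>.\<close>

lemma affine_maps_disjoint:
  assumes "c \<noteq> d"
  shows "affine_maps e n c \<inter> affine_maps e n d = {}"
proof (rule ccontr)
  assume "affine_maps e n c \<inter> affine_maps e n d \<noteq> {}"
  then obtain \<alpha> where \<alpha>: "\<alpha> \<in> affine_maps e n c" "\<alpha> \<in> affine_maps e n d"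
    by blast
  then have "dom \<alpha> \<noteq> {}"
    by (simp add: affine_maps_def)
  then obtain x where "x \<in> dom \<alpha>"
    by blast
  \<comment> \<open>The lower bounds are recorded because \<open>nat\<close> can be cancelled only
    between nonnegative integers.\<close>
  with \<alpha> have "nat (c + e * int x) = nat (d + e * int x)"
    "1 \<le> c + e * int x" "1 \<le> d + e * int x"
    by (auto simp: affine_maps_def affine_domain_def)
  with assms show False
    by linarith
qed

lemma affine_mapsD:
  assumes "\<alpha> \<in> affine_maps e n c" "x \<in> dom \<alpha>"
  shows "int (the (\<alpha> x)) = c + e * int x" "the (\<alpha> x) \<noteq> x" "x \<in> {1..n}" "the (\<alpha> x) \<in> {1..n}"
proof -
  have "x \<in> affine_domain e n c" "the (\<alpha> x) = nat (c + e * int x)"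
    using assms by (auto simp: affine_maps_def)
  then show "int (the (\<alpha> x)) = c + e * int x" "the (\<alpha> x) \<noteq> x" "x \<in> {1..n}" "the (\<alpha> x) \<in> {1..n}"
    by (auto simp: affine_domain_def)
qed

lemma card_UN_affine_maps:
  assumes "finite C"
  shows "card (\<Union>c\<in>C. affine_maps e n c) = (\<Sum>c\<in>C. 2 ^ card (affine_domain e n c) - 1)"
  using assms affine_maps_disjoint
  by (subst card_UN_disjoint) (auto simp: card_affine_maps)

section \<open>Sizes of the maximal fixed-point-free domains\<close>

lemma card_affine_domain_translation:
  "card (affine_domain 1 n c) = (if c = 0 then 0 else n - nat \<bar>c\<bar>)"
proof (cases "c = 0")
  case False
  then have "affine_domain 1 n c = {nat (max 1 (1 - c)) .. nat (min (int n) (int n - c))}"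
    by (auto simp: affine_domain_def)
  with False show ?thesis
    by (auto simp: max_def min_def)
qed (simp add: affine_domain_def)

text \<open>The offset is centred at \<open>n + 1\<close>, so that \<open>c = 0\<close> reverses the
  whole chain. The points kept inside the chain form an interval of length
  \<open>n - \<bar>c\<bar>\<close>, and the reflection can fix only its midpoint. The midpoint is an
  integer exactly for odd length, so deleting it rounds the length down to an even number.\<close>

lemma card_affine_domain_reflection:
  assumes "\<bar>c\<bar> \<le> int n"
  shows "card (affine_domain (-1) n (int n + 1 + c)) = 2 * ((n - nat \<bar>c\<bar>) div 2)"
proof -
  \<comment> \<open>The image of \<open>x\<close> lies in the chain iff
    \<open>1 + c \<le> x \<le> n + c\<close>; intersecting with the chain gives the ends
    \<open>a\<close> and \<open>b\<close>.\<close>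
  define a where "a = nat (max 1 (1 + c))"
  define b where "b = nat (min (int n) (int n + c))"
  have ab: "int a = max 1 (1 + c)" "int b = min (int n) (int n + c)"
    using assms by (auto simp: a_def b_def)
  \<comment> \<open>By the first equation the reflection swaps \<open>a\<close> and
    \<open>b\<close>, so a fixed point satisfies \<open>2 * x = a + b\<close>. The bound
    \<open>a \<le> Suc b\<close> keeps the natural subtraction exact, which the parity arguments
    use.\<close>
  have sum: "int a + int b = int n + 1 + c" and len: "Suc b - a = n - nat \<bar>c\<bar>" "a \<le> Suc b"
    using ab assms by linarith+
  have dom: "affine_domain (-1) n (int n + 1 + c) = {a..b} - {x. 2 * x = a + b}"
    unfolding affine_domain_def using ab sum by (auto simp: max_def min_def split: if_splits)
  show ?thesis
  proof (cases "even (a + b)")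
    case True
    then obtain m where m: "a + b = 2 * m"
      by (elim evenE)
    then have mid: "{x. 2 * x = a + b} = {m}"
      by auto
    show ?thesis
    proof (cases "a \<le> b")
      case True
      then have "m \<in> {a..b}"
        using m by auto
      then have "card ({a..b} - {m}) = Suc b - a - 1"
        by simp
      moreover have "Suc b - a - 1 = 2 * ((Suc b - a) div 2)"
        using m True by presburger
      ultimately show ?thesis
        unfolding dom mid using len by simp
    next
      case False
      with len show ?thesis
        unfolding dom by simp
    qed
  next
    case False
    then have "{x. 2 * x = a + b} = {}"
      by (metis (mono_tags, lifting) dvd_triv_left empty_Collect_eq)
    moreover have "Suc b - a = 2 * ((Suc b - a) div 2)"
      using False len(2) by presburger
    ultimately show ?thesis
      unfolding dom using len by simp
  qed
qed

lemma affine_maps_empty_translation: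
  assumes "c \<notin> {- int n..int n}"
  shows "affine_maps 1 n c = {}"
proof -
  have "affine_domain 1 n c = {}"
    using assms by (auto simp: affine_domain_def)
  then show ?thesis
    by (auto simp: affine_maps_def)
qed

lemma affine_maps_empty_reflection:
  assumes "c \<notin> {- int n..int n}"
  shows "affine_maps (-1) n (int n + 1 + c) = {}"
proof -
  have "affine_domain (-1) n (int n + 1 + c) = {}"
    using assms by (auto simp: affine_domain_def)
  then show ?thesis
    by (auto simp: affine_maps_def)
qed

section \<open>Summation over all offsets\<close>

lemma sum_abs_symmetric:
  fixes g :: "nat \<Rightarrow> real"
  shows "(\<Sum>c\<in>{- int n..int n}. g (nat \<bar>c\<bar>)) = g 0 + 2 * (\<Sum>m<n. g (Suc m))"
proof (induction n)
  case (Suc n)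
  have "{- int (Suc n)..int (Suc n)} =
      insert (int (Suc n)) (insert (- int (Suc n)) {- int n..int n})"
    by auto
  moreover have "nat \<bar>- int (Suc n)\<bar> = Suc n" "nat \<bar>int (Suc n)\<bar> = Suc n"
    by auto
  ultimately show ?case
    using Suc by (simp del: of_nat_Suc)
qed simp

definition translation_maps :: "nat \<Rightarrow> (nat \<rightharpoonup> nat) set" where
  "translation_maps n = (\<Union>c. affine_maps 1 n c)"

definition reflection_maps :: "nat \<Rightarrow> (nat \<rightharpoonup> nat) set" where
  "reflection_maps n = (\<Union>c. affine_maps (-1) n c)"

text \<open>Larger shifts move every point out of the chain; a finite index set is what the
  cardinality of a disjoint union requires.\<close>

lemma translation_maps_bounded: "translation_maps n = (\<Union>c\<in>{- int n..int n}. affine_maps 1 n c)"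
  unfolding translation_maps_def using affine_maps_empty_translation by fast

lemma reflection_maps_bounded:
  "reflection_maps n = (\<Union>c\<in>(+) (int n + 1) ` {- int n..int n}. affine_maps (-1) n c)"
proof -
  define C where "C = (+) (int n + 1) ` {- int n..int n}"
  have "c \<in> C" if "\<alpha> \<in> affine_maps (-1) n c" for \<alpha> c
    unfolding C_def using that affine_maps_empty_reflection[of "c - (int n + 1)" n]
    by (intro image_eqI[of _ _ "c - (int n + 1)"]) auto
  then show ?thesis
    unfolding reflection_maps_def C_def[symmetric] by blast
qed

lemma card_translation_maps: "real (card (translation_maps n)) = 2 * (\<Sum>m<n. 2 ^ m - 1)"
proof -
  \<comment> \<open>The value at 0 is special: the offset 0 gives the identity, whose nonempty
    restrictions all have fixed points.\<close>
  define g :: "nat \<Rightarrow> real" where "g m = (if m = 0 then 0 else 2 ^ (n - m) - 1)" for m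
  have "real (card (translation_maps n)) =
      (\<Sum>c\<in>{- int n..int n}. real (2 ^ card (affine_domain 1 n c) - 1))"
    unfolding translation_maps_bounded by (subst card_UN_affine_maps) simp_all
  also have "\<dots> = (\<Sum>c\<in>{- int n..int n}. g (nat \<bar>c\<bar>))"
    by (intro sum.cong) (auto simp: g_def card_affine_domain_translation of_nat_diff)
  also have "\<dots> = 2 * (\<Sum>m<n. 2 ^ (n - Suc m) - 1)"
    unfolding sum_abs_symmetric by (simp add: g_def)
  also have "(\<Sum>m<n. 2 ^ (n - Suc m) - 1 :: real) = (\<Sum>m<n. 2 ^ m - 1)"
    by (rule sum.nat_diff_reindex)
  finally show ?thesis .
qed

lemma card_reflection_maps:
  "real (card (reflection_maps n)) = 4 ^ (n div 2) - 1 + 2 * (\<Sum>m<n. 4 ^ (m div 2) - 1)"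
proof -
  \<comment> \<open>Domain sizes are even, so powers of 2 become powers of 4. Unlike for
    translations, the central offset contributes, and it gives the separate term
    \<open>4 ^ (n div 2) - 1\<close>.\<close>
  define g :: "nat \<Rightarrow> real" where "g m = 4 ^ ((n - m) div 2) - 1" for m
  have "real (card (reflection_maps n)) =
      (\<Sum>c\<in>{- int n..int n}. real (2 ^ card (affine_domain (-1) n (int n + 1 + c)) - 1))"
    unfolding reflection_maps_bounded
    by (subst card_UN_affine_maps, simp, subst sum.reindex) (simp_all add: inj_on_def)
  also have "\<dots> = (\<Sum>c\<in>{- int n..int n}. g (nat \<bar>c\<bar>))"
    by (intro sum.cong) (auto simp: g_def card_affine_domain_reflection of_nat_diff power_mult)
  also have "\<dots> = 4 ^ (n div 2) - 1 + 2 * (\<Sum>m<n. 4 ^ ((n - Suc m) div 2) - 1)"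
    unfolding sum_abs_symmetric by (simp add: g_def)
  also have "(\<Sum>m<n. 4 ^ ((n - Suc m) div 2) - 1 :: real) = (\<Sum>m<n. 4 ^ (m div 2) - 1)"
    by (rule sum.nat_diff_reindex)
  finally show ?thesis .
qed

section \<open>The overlap of the two families\<close>

lemma translation_maps_Int_reflection_maps:
  "translation_maps n \<inter> reflection_maps n =
     (\<lambda>(x, y). [x \<mapsto> y]) ` (SIGMA x:{1..n}. {1..n} - {x})" (is "?L = ?R")
proof
  show "?L \<subseteq> ?R"
  proof
    fix \<alpha> assume "\<alpha> \<in> ?L"
    then obtain c d where c: "\<alpha> \<in> affine_maps 1 n c" and d: "\<alpha> \<in> affine_maps (-1) n d"
      by (auto simp: translation_maps_def reflection_maps_def)
    from c obtain x y where xy: "\<alpha> x = Some y"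
      by (force simp: affine_maps_def)
    then have x: "x \<in> dom \<alpha>"
      by blast
    \<comment> \<open>Equating \<open>c + z\<close> with \<open>d - z\<close> gives
      \<open>2 * z = d - c\<close>, which has at most one solution.\<close>
    have "z = x" if "z \<in> dom \<alpha>" for z
      using affine_mapsD(1)[OF c that] affine_mapsD(1)[OF d that]
        affine_mapsD(1)[OF c x] affine_mapsD(1)[OF d x] by linarith
    then have "\<alpha> = [x \<mapsto> y]"
      using xy by (auto simp: fun_eq_iff)
    moreover have "x \<in> {1..n}" "y \<in> {1..n}" "x \<noteq> y"
      using affine_mapsD[OF c x] xy by auto
    ultimately show "\<alpha> \<in> ?R"
      by force
  qed
  show "?R \<subseteq> ?L"
  proof
    fix \<alpha> assume "\<alpha> \<in> ?R"
    then obtain p where p: "p \<in> (SIGMA x:{1..n}. {1..n} - {x})" "\<alpha> = (\<lambda>(x, y). [x \<mapsto> y]) p"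
      by blast
    obtain x y where "p = (x, y)"
      by (cases p)
    with p have "x \<in> {1..n}" "y \<in> {1..n}" "x \<noteq> y" and \<alpha>: "\<alpha> = [x \<mapsto> y]"
      by auto
    then have "\<alpha> \<in> affine_maps 1 n (int y - int x)" "\<alpha> \<in> affine_maps (-1) n (int y + int x)"
      by (auto simp: affine_maps_def affine_domain_def)
    then show "\<alpha> \<in> ?L"
      by (auto simp: translation_maps_def reflection_maps_def)
  qed
qed

lemma card_translation_maps_Int_reflection_maps: "card (translation_maps n \<inter> reflection_maps n) = n * n - n"
proof -
  have "inj (\<lambda>(x, y). [x \<mapsto> y :: nat] :: nat \<rightharpoonup> nat)"
    by (auto simp: inj_def fun_eq_iff split: if_splits)
  then have "card (translation_maps n \<inter> reflection_maps n) =
      card (SIGMA x:{1..n}. {1..n} - {x})"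
    unfolding translation_maps_Int_reflection_maps by (rule card_image[OF inj_on_subset]) simp
  also have "\<dots> = n * n - n"
    by (simp add: card_SigmaI diff_mult_distrib2)
  finally show ?thesis .
qed

section \<open>Classification of the fixed-point-free isometries\<close>

lemma affine_maps_subset_fixed_point_free:
  assumes "\<bar>e\<bar> = 1"
  shows "affine_maps e n c \<subseteq> fixed_point_free_isometries n"
proof
  fix \<alpha> assume \<alpha>: "\<alpha> \<in> affine_maps e n c"
  have val: "int (the (\<alpha> x)) = c + e * int x" "the (\<alpha> x) \<noteq> x"
    "x \<in> chain n" "the (\<alpha> x) \<in> chain n" if "x \<in> dom \<alpha>" for x
    using affine_mapsD[OF \<alpha> that] by (simp_all add: chain_def)
  have iso: "\<bar>int x - int y\<bar> = \<bar>int (the (\<alpha> x)) - int (the (\<alpha> y))\<bar>"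
    if "x \<in> dom \<alpha>" "y \<in> dom \<alpha>" for x y
  proof -
    have "int (the (\<alpha> x)) - int (the (\<alpha> y)) = e * (int x - int y)"
      using val(1) that by (simp add: algebra_simps)
    then show ?thesis
      using assms by (simp add: abs_mult)
  qed
  \<comment> \<open>Points with equal images have images at distance 0, hence are themselves at
    distance 0.\<close>
  have "inj_on \<alpha> (dom \<alpha>)"
    using iso by (fastforce intro: inj_onI)
  moreover have "ran \<alpha> \<subseteq> chain n"
    using val(4) by (force simp: ran_def)
  ultimately show "\<alpha> \<in> fixed_point_free_isometries n"
    unfolding fixed_point_free_isometries_def partial_isometries_def partial_injections_def
      fixed_points_def
    using val iso by blast
qed

text \<open>Reduces the classification to finding a slope and an offset: the range conditions and
  the absence of fixed points are inherited from \<alpha>.\<close>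

lemma fixed_point_free_affine:
  assumes "\<alpha> \<in> fixed_point_free_isometries n" "\<alpha> \<noteq> Map.empty"
    and "\<And>x. x \<in> dom \<alpha> \<Longrightarrow> int (the (\<alpha> x)) = c + e * int x"
  shows "\<alpha> \<in> affine_maps e n c"
proof -
  have "x \<in> affine_domain e n c \<and> \<alpha> x = Some (nat (c + e * int x))" if "x \<in> dom \<alpha>" for x
  proof -
    from that obtain y where y: "\<alpha> x = Some y"
      by blast
    then have "x \<in> {1..n}" "y \<in> {1..n}" "y \<noteq> x"
      using assms(1) that
      by (auto simp: fixed_point_free_isometries_def partial_isometries_def
          partial_injections_def fixed_points_def chain_def ran_def)
    moreover have "int y = c + e * int x"
      using assms(3)[OF that] y by simp
    ultimately show ?thesis
      using y by (auto simp: affine_domain_def simp flip: \<open>int y = c + e * int x\<close>)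
  qed
  with assms(2) show ?thesis
    by (auto simp: affine_maps_def)
qed

lemma fixed_point_free_isometries_eq:
  "fixed_point_free_isometries n = insert Map.empty (translation_maps n \<union> reflection_maps n)"
proof
  have "Map.empty \<in> fixed_point_free_isometries n"
    by (simp add: fixed_point_free_isometries_def partial_isometries_def partial_injections_def
        fixed_points_def)
  then show "insert Map.empty (translation_maps n \<union> reflection_maps n) \<subseteq> fixed_point_free_isometries n"
    using affine_maps_subset_fixed_point_free[of 1 n] affine_maps_subset_fixed_point_free[of "-1" n]
    unfolding translation_maps_def reflection_maps_def by auto
  show "fixed_point_free_isometries n \<subseteq> insert Map.empty (translation_maps n \<union> reflection_maps n)"
  proof
    fix \<alpha> assume \<alpha>: "\<alpha> \<in> fixed_point_free_isometries n"
    define f where "f x = int (the (\<alpha> x))" for x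
    have iso: "\<bar>int x - int y\<bar> = \<bar>f x - f y\<bar>" if "x \<in> dom \<alpha>" "y \<in> dom \<alpha>" for x y
      using \<alpha> that by (auto simp: fixed_point_free_isometries_def partial_isometries_def f_def)
    show "\<alpha> \<in> insert Map.empty (translation_maps n \<union> reflection_maps n)"
    proof (cases "\<alpha> = Map.empty")
      case False
      then obtain a where a: "a \<in> dom \<alpha>"
        by (metis all_not_in_conv dom_eq_empty_conv)
      show ?thesis
      \<comment> \<open>Relative to the base point \<open>a\<close>, every \<open>x\<close> keeps or
        reverses its signed distance; the question is whether the sign is uniform.\<close>
      proof (cases "\<forall>x\<in>dom \<alpha>. f x - f a = int x - int a")
        case True
        then have "\<alpha> \<in> affine_maps 1 n (f a - int a)"
          by (intro fixed_point_free_affine \<alpha> False) (auto simp: f_def algebra_simps)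
        then show ?thesis
          by (auto simp: translation_maps_def)
      next
        case nontrans: False
        then obtain b where b: "b \<in> dom \<alpha>" "f b - f a \<noteq> int b - int a"
          by blast
        \<comment> \<open>The point \<open>b\<close> reverses its nonzero displacement
          \<open>v = b - a\<close>. If some \<open>x\<close> kept a nonzero displacement
          \<open>u = x - a\<close>, then comparing \<open>x\<close> with \<open>b\<close> would give
          \<open>\<bar>u - v\<bar> = \<bar>u + v\<bar>\<close>, impossible when both are
          nonzero.\<close>
        have "f x = f a + int a - int x" if "x \<in> dom \<alpha>" for x
          using iso[OF a b(1)] iso[OF a that] iso[OF b(1) that] b(2) by linarith
        then have "\<alpha> \<in> affine_maps (-1) n (f a + int a)"
          by (intro fixed_point_free_affine \<alpha> False) (auto simp: f_def)
        then show ?thesis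
          by (auto simp: reflection_maps_def)
      qed
    qed simp
  qed
qed

section \<open>Inclusion-exclusion and closed forms\<close>

lemma card_fixed_point_free_isometries:
  "real (card (fixed_point_free_isometries n)) =
     4 ^ (n div 2) + 2 * (\<Sum>m<n. 2 ^ m - 1) + 2 * (\<Sum>m<n. 4 ^ (m div 2) - 1) - (real n)^2 + real n"
proof -
  have fin: "finite (translation_maps n)" "finite (reflection_maps n)"
    by (auto simp: translation_maps_bounded reflection_maps_bounded)
  have "Map.empty \<notin> translation_maps n \<union> reflection_maps n"
    by (auto simp: translation_maps_def reflection_maps_def affine_maps_def)
  \<comment> \<open>The empty map adds 1, which cancels the -1 in the central reflection
    term.\<close>
  then have "card (fixed_point_free_isometries n) = Suc (card (translation_maps n \<union> reflection_maps n))"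
    using fin by (simp add: fixed_point_free_isometries_eq)
  \<comment> \<open>Inclusion-exclusion is stated additively, so no truncated subtraction of
    cardinalities arises.\<close>
  moreover have "real (card (translation_maps n \<union> reflection_maps n)) + real (n * n - n) =
      real (card (translation_maps n)) + real (card (reflection_maps n))"
    using card_Un_Int[OF fin] card_translation_maps_Int_reflection_maps[of n] by linarith
  moreover have "real (n * n - n) = (real n)^2 - real n"
    by (simp add: of_nat_diff power2_eq_square)
  ultimately show ?thesis
    by (simp add: card_translation_maps card_reflection_maps)
qed

text \<open>The exponents \<open>m div 2\<close> come in equal pairs, so this is twice a geometric
  sum with ratio 4.\<close>

lemma sum_power_4_div_2: "(\<Sum>m<2 * j. 4 ^ (m div 2) :: real) = 2 * (4 ^ j - 1) / 3"
  by (induction j) (simp_all add: field_simps)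

theorem proposition3p20:
  fixes n :: nat
  shows "(even n \<longrightarrow>
           real (card (fixed_point_free_isometries n)) =
             (13 * 2 ^ n - (3 * (real n)^2 + 9 * real n + 10)) / 3)
       \<and> (odd n \<longrightarrow>
           real (card (fixed_point_free_isometries n)) =
             (25 * 2 ^ (n - 1) - (3 * (real n)^2 + 9 * real n + 10)) / 3)"
proof -
  have geometric: "(\<Sum>m<k. 2 ^ m :: real) = 2 ^ k - 1" for k :: nat
    by (induction k) simp_all
  have four: "(2 :: real) ^ (2 * j) = 4 ^ j" for j
    by (simp add: power_mult)
  show ?thesis
  proof (intro conjI impI)
    assume "even n"
    then obtain j where n: "n = 2 * j"
      by (elim evenE)
    show "real (card (fixed_point_free_isometries n)) =
        (13 * 2 ^ n - (3 * (real n)^2 + 9 * real n + 10)) / 3"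
      unfolding card_fixed_point_free_isometries sum_subtractf geometric
      by (simp add: n sum_power_4_div_2 four) (simp add: field_simps power2_eq_square)
  next
    assume "odd n"
    \<comment> \<open>For odd \<open>n\<close> the sum of the \<open>4 ^ (m div 2)\<close> has one
      unpaired last term \<open>4 ^ j\<close>, and \<open>2 ^ (n - 1)\<close> equals
      \<open>4 ^ j\<close>.\<close>
    then obtain j where n: "n = Suc (2 * j)"
      by (auto elim: oddE)
    show "real (card (fixed_point_free_isometries n)) =
        (25 * 2 ^ (n - 1) - (3 * (real n)^2 + 9 * real n + 10)) / 3"
      unfolding card_fixed_point_free_isometries sum_subtractf geometric
      by (simp add: n sum_power_4_div_2 four) (simp add: field_simps power2_eq_square)
  qed
qed

end
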